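(* Let $M$ be a positive integer and let $k$ be an integer with $1 \le k < 10$. Then $M$ is a $(10,k)$-reverse multiple if and only if one of the following conditions is satisfied: 1. $k = 1$ and $M$ is a palindrome; 2. $k = 4$ and there exist an integer $i \ge 1$ and non-negative integers $l_1,\dots,l_i$ and $m_1, m_2, \dots$ such that, writing $B_j = 21\underbrace{9\cdots9}_{l_j}78$, the decimal expansion of $M$ is $$B_1\,\underbrace{0\cdots0}_{m_1}\,B_2\,\underbrace{0\cdots0}_{m_2}\cdots\underbrace{0\cdots0}_{m_{i-1}}\,B_i\,\underbrace{0\cdots0}_{m_i}\,B_i\,\underbrace{0\cdots0}_{m_{i-1}}\cdots\underbrace{0\cdots0}_{m_2}\,B_2\,\underbrace{0\cdots0}_{m_1}\,B_1$$ (with $2i$ blocks), or $$B_1\,\underbrace{0\cdots0}_{m_1}\,B_2\cdots B_{i-1}\,\underbrace{0\cdots0}_{m_{i-1}}\,B_i\,\underbrace{0\cdots0}_{m_{i-1}}\,B_{i-1}\cdots B_2\,\underbrace{0\cdots0}_{m_1}\,B_1$$ (with $2i-1$ blocks); 3. $k = 9$ and there exist an integer $i \ge 1$ and non-negative integers $l_1,\dots,l_i$ and $m_1, m_2, \dots$ such that, writing $C_j = 10\underbrace{9\cdots9}_{l_j}89$, the decimal expansion of $M$ is $$C_1\,\underbrace{0\cdots0}_{m_1}\,C_2\,\underbrace{0\cdots0}_{m_2}\cdots\underbrace{0\cdots0}_{m_{i-1}}\,C_i\,\underbrace{0\cdots0}_{m_i}\,C_i\,\underbrace{0\cdots0}_{m_{i-1}}\cdots\underbrace{0\cdots0}_{m_2}\,C_2\,\underbrace{0\cdots0}_{m_1}\,C_1$$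 (with $2i$ blocks), or $$C_1\,\underbrace{0\cdots0}_{m_1}\,C_2\cdots C_{i-1}\,\underbrace{0\cdots0}_{m_{i-1}}\,C_i\,\underbrace{0\cdots0}_{m_{i-1}}\,C_{i-1}\cdots C_2\,\underbrace{0\cdots0}_{m_1}\,C_1$$ (with $2i-1$ blocks).
   Context: For an integer $k$ with $1 \le k < 10$, a positive integer $M$ is called a $(10,k)$-reverse multiple if the reversal of the decimal expansion of $M$ is the decimal expansion of the product $kM$; that is, if $M$ has decimal digits $a_n a_{n-1}\cdots a_1 a_0$ (with $a_n \ne 0$), then $kM$ has decimal expansion $a_0 a_1 \cdots a_{n-1} a_n$. A palindrome is a positive integer whose decimal expansion reads the same forward and backward. Juxtaposition in the displayed forms denotes concatenation of strings of decimal digits. The notation $\underbrace{9\cdots9}_{l}$ (respectively $\underbrace{0\cdots0}_{m}$) denotes a string of $l$ nines (respectively $m$ zeros), which is empty when $l=0$ (respectively $m=0$). In each form the whole sequence of blocks and zero-strings is symmetric about its centre: in the form with $2i$ blocks the centre is a string of $m_i$ zeros, with one copy of the $i$-th block on each side; in the form with $2i-1$ blocks the centre is the single $i$-th block. For $i=1$ the form with $2i$ blocks is $B_1\,\underbrace{0\cdots0}_{m_1}\,B_1$ (respectively $C_1\,\underbrace{0\cdots0}_{m_1}\,C_1$) and the form with $2i-1$ blocks is just $B_1$ (respectively $C_1$). *)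

theory Defs
  imports Main
begin

text \<open>Digit strings are lists, most significant digit first.\<close>

fun decimal_expansion :: "nat \<Rightarrow> nat list" where
  "decimal_expansion n =
     (if n < 10 then [n] else decimal_expansion (n div 10) @ [n mod 10])"

text \<open>The defining equation loops as a rewrite rule.\<close>
declare decimal_expansion.simps [simp del]

definition reverse_multiple :: "nat \<Rightarrow> nat \<Rightarrow> bool" where
  "reverse_multiple k M \<longleftrightarrow>
     M > 0 \<and> decimal_expansion (k * M) = rev (decimal_expansion M)"

definition palindrome :: "nat \<Rightarrow> bool" where
  "palindrome M \<longleftrightarrow> M > 0 \<and> rev (decimal_expansion M) = decimal_expansion M"

definition nines :: "nat \<Rightarrow> nat list" where
  "nines l = replicate l 9"

definition zeros :: "nat \<Rightarrow> nat list" where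
  "zeros m = replicate m 0"

definition block_B :: "nat \<Rightarrow> nat list" where
  "block_B l = [2, 1] @ nines l @ [7, 8]"

definition block_C :: "nat \<Rightarrow> nat list" where
  "block_C l = [1, 0] @ nines l @ [8, 9]"

text \<open>
  In the following, \<open>X j\<close> is the \<open>j\<close>-th block and \<open>m j\<close> the length of the \<open>j\<close>-th
  string of zeros, both indexed from 1. The left wing is \<open>X\<^sub>1 0\<dots>0 X\<^sub>2 0\<dots>0 \<dots> X\<^sub>i\<^sub>-\<^sub>1 0\<dots>0\<close>,
  with zero strings of lengths \<open>m\<^sub>1, \<dots>, m\<^sub>i\<^sub>-\<^sub>1\<close>. The right wing has the pieces in the opposite
  order, but the digits inside each block are not reversed.
\<close>

definition left_wing :: "(nat \<Rightarrow> nat list) \<Rightarrow> (nat \<Rightarrow> nat) \<Rightarrow> nat \<Rightarrow> nat list" where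
  "left_wing X m i = concat (map (\<lambda>j. X j @ zeros (m j)) [1..<i])"

definition right_wing :: "(nat \<Rightarrow> nat list) \<Rightarrow> (nat \<Rightarrow> nat) \<Rightarrow> nat \<Rightarrow> nat list" where
  "right_wing X m i = concat (map (\<lambda>j. zeros (m j) @ X j) (rev [1..<i]))"

text \<open>The symmetric sequences with \<open>2 * i\<close> and \<open>2 * i - 1\<close> blocks, for \<open>i \<ge> 1\<close>.\<close>

definition even_form :: "(nat \<Rightarrow> nat list) \<Rightarrow> (nat \<Rightarrow> nat) \<Rightarrow> nat \<Rightarrow> nat list" where
  "even_form X m i = left_wing X m i @ X i @ zeros (m i) @ X i @ right_wing X m i"

definition odd_form :: "(nat \<Rightarrow> nat list) \<Rightarrow> (nat \<Rightarrow> nat) \<Rightarrow> nat \<Rightarrow> nat list" where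
  "odd_form X m i = left_wing X m i @ X i @ right_wing X m i"

end

theory Submission
  imports Defs
begin

text \<open>
  The equation \<open>k * M = M reversed\<close> is a long multiplication, and it can be checked from both ends
  of the digit string at once. Stripping the first digit \<open>x\<close> and the last digit \<open>y\<close> leaves
  a problem of the same kind for the inner string, with one carry \<open>c\<close> entering it at its right
  end and one carry \<open>d\<close> that it must hand over at its left end (lemma \<open>balanced_peel\<close>). So the
  solutions are the paths, starting from the carries \<open>(0, 0)\<close>, of a finite automaton whose states
  are the pairs \<open>(c, d)\<close> with \<open>c, d < k\<close> and whose letters are pairs of digits.

  For most \<open>k\<close> the first step is already impossible with a nonzero leading digit; only
  \<open>k = 1, 4, 9\<close> survive (\<open>multiplier_1_4_9\<close>), and \<open>k = 1\<close> gives the palindromes. For the other two,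
  put \<open>e = 10 div (k + 1)\<close>, that is, \<open>e = 2\<close> or \<open>e = 1\<close>. The reachable part of the automaton is the
  same cycle in both cases:

    \<open>(0, 0) \<rightarrow> (k-1, 0) \<rightarrow> (k-1, k-1) \<rightarrow> (0, k-1) \<rightarrow> (0, 0)\<close>

  with the letters \<open>(e, 10-e)\<close>, \<open>(e-1, 9-e)\<close>, \<open>(9-e, e-1)\<close>, \<open>(10-e, e)\<close> on its edges, a loop
  \<open>(0, 0)\<close> at the first state and a loop \<open>(9, 9)\<close> at the third. The inner string may
  end only at these two symmetric states. One turn round the cycle therefore writes, on the left and
  on the right, the same block \<open>e (e-1) 9...9 (9-e) (10-e)\<close>; the loop \<open>(0, 0)\<close> writes equally many
  zeros on both sides between blocks. Ending at \<open>(0, 0)\<close> gives an even number of blocks around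
  a central string of zeros, ending at the state of the nines gives a central block.

  Conversely no automaton is needed: \<open>k\<close> times a single block is its reversal, and the property is
  inherited by \<open>a @ u @ a\<close> from \<open>a\<close> and \<open>u\<close>, since no carries cross the seams
  (\<open>balanced_0_0_sandwich\<close>).
\<close>

section \<open>Digit strings and their values\<close>

fun digit_value :: "nat list \<Rightarrow> nat" where
  "digit_value [] = 0"
| "digit_value (x # xs) = x * 10 ^ length xs + digit_value xs"

lemma digit_value_append [simp]:
  "digit_value (xs @ ys) = digit_value xs * 10 ^ length ys + digit_value ys"
  by (induction xs) (auto simp: power_add algebra_simps)

lemma digit_value_less: "\<forall>x\<in>set xs. x < 10 \<Longrightarrow> digit_value xs < 10 ^ length xs"
proof (induction xs)
  case (Cons x xs)
  have "x * 10 ^ length xs \<le> 9 * 10 ^ length xs"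
    using Cons.prems by (intro mult_right_mono) auto
  moreover have "digit_value xs < 10 ^ length xs" using Cons by simp
  ultimately have "x * 10 ^ length xs + digit_value xs < 10 * 10 ^ length xs" by linarith
  then show ?case by simp
qed simp

lemma digit_value_zeros [simp]: "digit_value (zeros m) = 0"
  by (induction m) (auto simp: zeros_def)

lemma digit_value_nines: "digit_value (nines l) + 1 = 10 ^ l"
  by (induction l) (auto simp: nines_def)

lemma digit_value_decimal_expansion [simp]: "digit_value (decimal_expansion n) = n"
proof (induction n rule: decimal_expansion.induct)
  case (1 n)
  then show ?case by (subst decimal_expansion.simps) auto
qed

lemma decimal_expansion_digits: "\<forall>x\<in>set (decimal_expansion n). x < 10"
proof (induction n rule: decimal_expansion.induct)
  case (1 n)
  then show ?case by (subst decimal_expansion.simps) auto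
qed

lemma decimal_expansion_not_Nil [simp]: "decimal_expansion n \<noteq> []"
  by (subst decimal_expansion.simps) auto

lemma hd_decimal_expansion: "n > 0 \<Longrightarrow> hd (decimal_expansion n) \<noteq> 0"
proof (induction n rule: decimal_expansion.induct)
  case (1 n)
  then show ?case by (subst decimal_expansion.simps) auto
qed

lemma decimal_expansion_digit_value:
  "\<lbrakk>\<forall>x\<in>set w. x < 10; w \<noteq> []; hd w \<noteq> 0\<rbrakk> \<Longrightarrow> decimal_expansion (digit_value w) = w"
proof (induction w rule: rev_induct)
  case (snoc x w)
  show ?case
  proof (cases "w = []")
    case True
    then show ?thesis using snoc.prems by (subst decimal_expansion.simps) auto
  next
    case False
    then have IH: "decimal_expansion (digit_value w) = w"
      using snoc by auto
    have "digit_value w \<noteq> 0"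
    proof
      assume "digit_value w = 0"
      then have "w = [0]" using IH by (simp add: decimal_expansion.simps)
      then show False using snoc.prems by simp
    qed
    then show ?thesis
      using snoc.prems IH by (subst decimal_expansion.simps) auto
  qed
qed simp

text \<open>
  Comparing values suffices: if the last digit of \<open>M\<close> were \<open>0\<close>, the reversal would be
  smaller than \<open>M\<close> and so could not be \<open>k * M\<close>. Hence the reversed string has no leading zero and
  is determined by its value.
\<close>

lemma reverse_multiple_iff_digit_value:
  assumes "k \<ge> 1"
  shows "reverse_multiple k M \<longleftrightarrow> M > 0 \<and> k * M = digit_value (rev (decimal_expansion M))"
proof (intro iffI conjI)
  assume "reverse_multiple k M"
  then show "M > 0" "k * M = digit_value (rev (decimal_expansion M))"
    unfolding reverse_multiple_def by (auto dest!: arg_cong[where f = digit_value])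
next
  let ?w = "decimal_expansion M"
  assume M: "M > 0 \<and> k * M = digit_value (rev ?w)"
  have "last ?w \<noteq> 0"
  proof
    assume last: "last ?w = 0"
    obtain u where u: "?w = u @ [0]"
      using last by (metis append_butlast_last_id decimal_expansion_not_Nil)
    have "u \<noteq> []"
    proof
      assume "u = []"
      then have "hd ?w = 0" using u by simp
      then show False using M hd_decimal_expansion by blast
    qed
    then obtain x v where v: "u = x # v" "x \<noteq> 0"
      using u M hd_decimal_expansion[of M] by (cases u) auto
    have "digit_value (rev ?w) < 10 ^ length u"
      using digit_value_less[of "rev u"] decimal_expansion_digits[of M] u by auto
    moreover have "10 ^ length u \<le> digit_value ?w"
    proof -
      have "10 ^ length u \<le> x * 10 ^ length u" using v by simp
      also have "\<dots> \<le> digit_value ?w" using u v by simp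
      finally show ?thesis .
    qed
    moreover have "digit_value ?w \<le> k * M"
      using assms by simp
    ultimately show False using M by linarith
  qed
  then have "decimal_expansion (digit_value (rev ?w)) = rev ?w"
    using decimal_expansion_digits[of M]
    by (intro decimal_expansion_digit_value) (auto simp: hd_rev)
  then show "reverse_multiple k M"
    using M unfolding reverse_multiple_def by simp
qed


section \<open>Multiplication with carries, read from both ends\<close>

text \<open>
  Multiplying the string \<open>w\<close> by \<open>k\<close>, with carry \<open>c\<close> coming in at the units, writes the
  reversal of \<open>w\<close> in the same positions and leaves the carry \<open>d\<close> at the left end.
\<close>

definition balanced :: "nat \<Rightarrow> nat \<Rightarrow> nat \<Rightarrow> nat list \<Rightarrow> bool" where
  "balanced k c d w \<longleftrightarrow>
     k * digit_value w + c = digit_value (rev w) + d * 10 ^ length w"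

lemma balanced_Nil [simp]: "balanced k c d [] \<longleftrightarrow> c = d"
  by (simp add: balanced_def)

lemma balanced_single [simp]: "balanced k c d [x] \<longleftrightarrow> k * x + c = x + d * 10"
  by (simp add: balanced_def)

text \<open>
  Here \<open>c'\<close> is the carry out of the units, found by reading the equation modulo \<open>10\<close>, and \<open>d'\<close> the
  carry that must reach the leading position to produce \<open>y\<close> and the outgoing \<open>d\<close> there. The
  leading digits leave a difference in which the inner string accounts for less than one unit, which
  is why \<open>d'\<close> is not negative; both carries stay below \<open>k\<close> because all digits are at most \<open>9\<close>.
\<close>

lemma balanced_peel:
  assumes bal: "balanced k c d (x # u @ [y])" and c: "c < k"
    and digits: "\<forall>z\<in>set (x # u @ [y]). z < 10"
  obtains c' d' where "k * y + c = 10 * c' + x" and "k * x + d' = 10 * d + y"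
    and "c' < k" and "d' < k" and "balanced k c' d' u"
proof -
  define N where "N = (10::nat) ^ length u"
  define U where "U = digit_value u"
  define V where "V = digit_value (rev u)"
  have UV: "U < N" "V < N"
    using digit_value_less[of u] digit_value_less[of "rev u"] digits
    by (auto simp: U_def V_def N_def)
  have xy: "x < 10" "y < 10" using digits by auto
  have eq: "10 * (k * x * N + k * U) + (k * y + c) = 10 * (y * N + V + 10 * d * N) + x"
    using bal unfolding balanced_def U_def V_def N_def by (simp add: algebra_simps)
  define c' where "c' = (k * y + c) div 10"
  have "(k * y + c) mod 10 = x"
    using arg_cong[OF eq, of "\<lambda>n. n mod 10"] xy unfolding mod_mult_self4 by simp
  then have 1: "k * y + c = 10 * c' + x"
    unfolding c'_def by (metis mult_div_mod_eq)
  have eq': "k * x * N + k * U + c' = y * N + V + 10 * d * N"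
  proof -
    have cancel: "A + c' = B" if "10 * A + p = 10 * B + x" "p = 10 * c' + x" for A B p :: nat
      using that by linarith
    show ?thesis using cancel[OF eq 1] .
  qed
  have "k * y \<le> k * 9" using xy by (intro mult_left_mono) auto
  then have c': "c' < k" using 1 c by linarith
  have "k * x < 10 * d + y + 1"
  proof (rule ccontr)
    assume "\<not> k * x < 10 * d + y + 1"
    then have "(10 * d + y + 1) * N \<le> k * x * N" by (intro mult_right_mono) auto
    then show False using eq' UV by (simp add: algebra_simps)
  qed
  then obtain d' where 2: "10 * d + y = k * x + d'"
    using le_Suc_ex[of "k * x" "10 * d + y"] by auto
  have "(10 * d + y) * N = (k * x + d') * N" using 2 by simp
  then have 3: "k * U + c' = V + d' * N"
    using eq' by (simp add: algebra_simps)
  have "d' < k"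
  proof (rule ccontr)
    assume "\<not> d' < k"
    then have "k * N \<le> d' * N" by simp
    moreover have "k * Suc U \<le> k * N" using UV by (intro mult_left_mono) auto
    ultimately show False using 3 c' unfolding mult_Suc_right by linarith
  qed
  with 1 2 3 c' show thesis
    by (intro that[of c' d']) (auto simp: balanced_def U_def V_def N_def)
qed

lemma list_ends_cases:
  obtains "w = []" | x where "w = [x]" | x u y where "w = x # u @ [y]"
  by (metis neq_Nil_conv rev_exhaust)

text \<open>
  Once \<open>y\<close> is known, the remaining data of a step are computed from it; running through the ten
  values of \<open>y\<close> thus decides every question about the possible steps.
\<close>

lemma digit_pair_determined:
  assumes "k * y + c = 10 * c' + x" "k * x + d' = 10 * d + y" "x < (10::nat)"
  shows "x = (k * y + c) mod 10" "c' = (k * y + c) div 10" "d' = 10 * d + y - k * x"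
  using assms by auto

lemma digit_cases:
  assumes "y < (10::nat)"
  shows "y \<in> {0,1,2,3,4,5,6,7,8,9}"
  using assms by auto

text \<open>
  The outermost digits alone decide this: no carry leaves the number, so \<open>y\<close> lies between
  \<open>k * x\<close> and \<open>k * x + k - 1\<close>, while \<open>x\<close> must be the last digit of \<open>k * y\<close>.
\<close>

lemma multiplier_1_4_9:
  assumes "balanced k 0 0 w" "w \<noteq> []" "hd w \<noteq> 0" "\<forall>z\<in>set w. z < 10" "1 \<le> k" "k < 10"
  shows "k = 1 \<or> k = 4 \<or> k = 9"
proof (cases w rule: list_ends_cases)
  case 1
  then show ?thesis using assms by simp
next
  case (2 x)
  then show ?thesis using assms by simp
next
  case (3 x u y)
  obtain c' d' where eqs: "k * y + 0 = 10 * c' + x" "k * x + d' = 10 * 0 + y"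
    and d': "d' < k"
    using balanced_peel[of k 0 0 x u y] assms 3 by (metis less_le_trans zero_less_one)
  have xy: "x < 10" "y < 10" "x \<noteq> 0" using assms 3 by auto
  have "k \<in> {1,2,3,4,5,6,7,8,9}" using assms by auto
  then show ?thesis
    using digit_cases[OF xy(2)] digit_pair_determined(1)[OF eqs xy(1)] xy(3) eqs(2) d'
    by (elim insertE emptyE; hypsubst; simp)
qed


section \<open>The carry transitions for the multipliers 4 and 9\<close>

text \<open>
  With \<open>(k + 1) * e = 10\<close> the two families of blocks become one, and so do the two automata:
  \<open>k = 4\<close> goes with \<open>e = 2\<close> and \<open>k = 9\<close> with \<open>e = 1\<close>.
\<close>

definition block :: "nat \<Rightarrow> nat \<Rightarrow> nat list" where
  "block e l = [e, e - 1] @ nines l @ [9 - e, 10 - e]"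

lemma block_B_eq: "block_B = block 2"
  by (simp add: fun_eq_iff block_B_def block_def)

lemma block_C_eq: "block_C = block 1"
  by (simp add: fun_eq_iff block_C_def block_def)

definition block_case :: "nat \<Rightarrow> nat \<Rightarrow> bool" where
  "block_case k e \<longleftrightarrow> k = 4 \<and> e = 2 \<or> k = 9 \<and> e = 1"

text \<open>
  The next four lemmas are the edges leaving the four states of the cycle, in the order in which the
  cycle is run through.
\<close>

lemma digit_pair_0_0:
  assumes "block_case k e" "x < 10" "y < 10" "c' < k" "d' < k"
    "k * y + 0 = 10 * c' + x" "k * x + d' = 10 * 0 + y"
  shows "x = 0 \<and> y = 0 \<and> c' = 0 \<and> d' = 0 \<or> x = e \<and> y = 10 - e \<and> c' = k - 1 \<and> d' = 0"
  using digit_cases[OF assms(3)] digit_pair_determined[OF assms(6,7,2)] assms(1,5,7)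
  unfolding block_case_def by (elim insertE emptyE disjE conjE; simp)

lemma digit_pair_carry_0:
  assumes "block_case k e" "x < 10" "y < 10" "c' < k" "d' < k"
    "k * y + (k - 1) = 10 * c' + x" "k * x + d' = 10 * 0 + y"
  shows "x = e - 1 \<and> y = 9 - e \<and> c' = k - 1 \<and> d' = k - 1"
  using digit_cases[OF assms(3)] digit_pair_determined[OF assms(6,7,2)] assms(1,5,7)
  unfolding block_case_def by (elim insertE emptyE disjE conjE; simp)

lemma digit_pair_carry_carry:
  assumes "block_case k e" "x < 10" "y < 10" "c' < k" "d' < k"
    "k * y + (k - 1) = 10 * c' + x" "k * x + d' = 10 * (k - 1) + y"
  shows "x = 9 \<and> y = 9 \<and> c' = k - 1 \<and> d' = k - 1 \<or>
    x = 9 - e \<and> y = e - 1 \<and> c' = 0 \<and> d' = k - 1"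
  using digit_cases[OF assms(3)] digit_pair_determined[OF assms(6,7,2)] assms(1,5,7)
  unfolding block_case_def by (elim insertE emptyE disjE conjE; simp)

lemma digit_pair_0_carry:
  assumes "block_case k e" "x < 10" "y < 10" "c' < k" "d' < k"
    "k * y + 0 = 10 * c' + x" "k * x + d' = 10 * (k - 1) + y"
  shows "x = 10 - e \<and> y = e \<and> c' = 0 \<and> d' = 0"
  using digit_cases[OF assms(3)] digit_pair_determined[OF assms(6,7,2)] assms(1,5,7)
  unfolding block_case_def by (elim insertE emptyE disjE conjE; simp)

lemma block_case_pos: "block_case k e \<Longrightarrow> 0 < k \<and> k - 1 < k"
  by (auto simp: block_case_def)

text \<open>
  The same edges as statements about strings. Strings of length at most one are the places where a
  path may stop: this happens only at the two states with equal carries, and a central digit there is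
  the digit of the loop.
\<close>

lemma balanced_0_0_cases:
  assumes ke: "block_case k e" and bal: "balanced k 0 0 w" and digits: "\<forall>z\<in>set w. z < 10"
  obtains "w = []" | "w = [0]"
  | u where "w = 0 # u @ [0]" "balanced k 0 0 u"
  | u where "w = e # u @ [10 - e]" "balanced k (k - 1) 0 u"
proof (cases w rule: list_ends_cases)
  case (2 x)
  then show thesis using that(2) bal ke by (auto simp: block_case_def)
next
  case (3 x u y)
  have xy: "x < 10" "y < 10" using digits 3 by auto
  show thesis
    using bal digits block_case_pos[OF ke] unfolding 3
    by (elim balanced_peel) (use digit_pair_0_0[OF ke xy] that(3,4) 3 in blast)+
qed (use that in auto)

lemma balanced_carry_0_cases:
  assumes ke: "block_case k e" and bal: "balanced k (k - 1) 0 w" and digits: "\<forall>z\<in>set w. z < 10"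
  obtains u where "w = (e - 1) # u @ [9 - e]" "balanced k (k - 1) (k - 1) u"
proof (cases w rule: list_ends_cases)
  case (3 x u y)
  have xy: "x < 10" "y < 10" using digits 3 by auto
  show thesis
    using bal digits block_case_pos[OF ke] unfolding 3
    by (elim balanced_peel) (use digit_pair_carry_0[OF ke xy] that 3 in blast)+
qed (use bal ke in \<open>auto simp: block_case_def\<close>)

lemma balanced_carry_carry_cases:
  assumes ke: "block_case k e" and bal: "balanced k (k - 1) (k - 1) w"
    and digits: "\<forall>z\<in>set w. z < 10"
  obtains "w = []" | "w = [9]"
  | u where "w = 9 # u @ [9]" "balanced k (k - 1) (k - 1) u"
  | u where "w = (9 - e) # u @ [e - 1]" "balanced k 0 (k - 1) u"
proof (cases w rule: list_ends_cases)
  case (2 x)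
  then show thesis using that(2) bal ke by (auto simp: block_case_def)
next
  case (3 x u y)
  have xy: "x < 10" "y < 10" using digits 3 by auto
  show thesis
    using bal digits block_case_pos[OF ke] unfolding 3
    by (elim balanced_peel) (use digit_pair_carry_carry[OF ke xy] that(3,4) 3 in blast)+
qed (use that in auto)

lemma balanced_0_carry_cases:
  assumes ke: "block_case k e" and bal: "balanced k 0 (k - 1) w" and digits: "\<forall>z\<in>set w. z < 10"
  obtains u where "w = (10 - e) # u @ [e]" "balanced k 0 0 u"
proof (cases w rule: list_ends_cases)
  case (2 x)
  then show thesis using bal ke digits by (auto simp: block_case_def)
next
  case (3 x u y)
  have xy: "x < 10" "y < 10" using digits 3 by auto
  show thesis
    using bal digits block_case_pos[OF ke] unfolding 3
    by (elim balanced_peel) (use digit_pair_0_carry[OF ke xy] that 3 in blast)+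
qed (use bal ke in \<open>auto simp: block_case_def\<close>)


section \<open>Symmetric sequences of blocks\<close>

lemma nines_Suc: "nines (Suc l) = 9 # nines l" "nines (Suc l) = nines l @ [9]"
  by (simp_all add: nines_def replicate_append_same)

lemma zeros_Suc: "zeros (Suc m) = 0 # zeros m" "zeros (Suc m) = zeros m @ [0]"
  by (simp_all add: zeros_def replicate_append_same)

lemma upt_1_Suc: "1 \<le> i \<Longrightarrow> [1..<Suc i] = 1 # map Suc [1..<i]"
  by (simp add: upt_conv_Cons map_Suc_upt del: upt_Suc)

text \<open>
  The recursion peels off the outermost block and zeros on both sides, as the automaton does. The
  inner form is again indexed from 1, so \<open>Y\<close> and \<open>n\<close> have to agree with the shifts of \<open>X\<close> and \<open>m\<close>
  at positive indices only.
\<close>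

lemma wings_Suc:
  assumes "1 \<le> i" "\<And>j. 1 \<le> j \<Longrightarrow> X (Suc j) = Y j" "\<And>j. 1 \<le> j \<Longrightarrow> m (Suc j) = n j"
  shows "left_wing X m (Suc i) = X 1 @ zeros (m 1) @ left_wing Y n i"
    and "right_wing X m (Suc i) = right_wing Y n i @ zeros (m 1) @ X 1"
proof -
  have "map (\<lambda>j. X (Suc j) @ zeros (m (Suc j))) [1..<i] = map (\<lambda>j. Y j @ zeros (n j)) [1..<i]"
    "map (\<lambda>j. zeros (m (Suc j)) @ X (Suc j)) (rev [1..<i]) = map (\<lambda>j. zeros (n j) @ Y j) (rev [1..<i])"
    using assms by (intro map_cong; simp)+
  then show "left_wing X m (Suc i) = X 1 @ zeros (m 1) @ left_wing Y n i"
    and "right_wing X m (Suc i) = right_wing Y n i @ zeros (m 1) @ X 1"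
    unfolding left_wing_def right_wing_def upt_1_Suc[OF assms(1)]
    by (simp_all only: rev_map map_map o_def rev.simps list.map map_append concat.simps
        concat_append append_assoc append_Nil append_Nil2 One_nat_def)
qed

lemma forms_Suc:
  assumes "1 \<le> i" "\<And>j. 1 \<le> j \<Longrightarrow> X (Suc j) = Y j" "\<And>j. 1 \<le> j \<Longrightarrow> m (Suc j) = n j"
  shows "even_form X m (Suc i) = X 1 @ zeros (m 1) @ even_form Y n i @ zeros (m 1) @ X 1"
    and "odd_form X m (Suc i) = X 1 @ zeros (m 1) @ odd_form Y n i @ zeros (m 1) @ X 1"
  using wings_Suc[of i X Y m n] assms unfolding even_form_def odd_form_def by simp_all

lemma forms_1:
  "even_form X m 1 = X 1 @ zeros (m 1) @ X 1" "odd_form X m 1 = X 1"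
  by (simp_all add: even_form_def odd_form_def left_wing_def right_wing_def)

definition block_form :: "nat \<Rightarrow> nat list \<Rightarrow> bool" where
  "block_form e w \<longleftrightarrow> (\<exists>i\<ge>1. \<exists>l m :: nat \<Rightarrow> nat.
     w = even_form (\<lambda>j. block e (l j)) m i \<or> w = odd_form (\<lambda>j. block e (l j)) m i)"

lemma block_form_single: "block_form e (block e a)"
proof -
  have "block e a = odd_form (\<lambda>j. block e ((\<lambda>_. a) j)) m 1" for m
    by (simp only: forms_1)
  then show ?thesis unfolding block_form_def by (meson le_refl)
qed

lemma block_form_pair: "block_form e (block e a @ zeros b @ block e a)"
proof -
  have "block e a @ zeros b @ block e a = even_form (\<lambda>j. block e ((\<lambda>_. a) j)) (\<lambda>_. b) 1"
    by (simp only: forms_1)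
  then show ?thesis unfolding block_form_def by (meson le_refl)
qed

lemma block_form_nest:
  assumes "block_form e w"
  shows "block_form e (block e a @ zeros b @ w @ zeros b @ block e a)"
proof -
  obtain i l m where i: "i \<ge> 1"
    and w: "w = even_form (\<lambda>j. block e (l j)) m i \<or> w = odd_form (\<lambda>j. block e (l j)) m i"
    using assms unfolding block_form_def by blast
  define l' where "l' = (\<lambda>j. if j = 1 then a else l (j - 1))"
  define m' where "m' = (\<lambda>j. if j = 1 then b else m (j - 1))"
  have *: "l' 1 = a" "m' 1 = b" "block e (l' (Suc j)) = block e (l j)" "m' (Suc j) = m j"
    if "1 \<le> j" for j
    using that by (auto simp: l'_def m'_def)
  have
    "even_form (\<lambda>j. block e (l' j)) m' (Suc i) =
      block e a @ zeros b @ even_form (\<lambda>j. block e (l j)) m i @ zeros b @ block e a"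
    "odd_form (\<lambda>j. block e (l' j)) m' (Suc i) =
      block e a @ zeros b @ odd_form (\<lambda>j. block e (l j)) m i @ zeros b @ block e a"
    using forms_Suc[of i "\<lambda>j. block e (l' j)" "\<lambda>j. block e (l j)" m' m] i * by auto
  then show ?thesis unfolding block_form_def using w by (metis le_SucI i)
qed

text \<open>
  Block forms are thus exactly the strings generated by three rules, without reference to the
  indexing of the blocks.
\<close>

lemma block_form_induct [consumes 1, case_names single pair nest]:
  assumes "block_form e w"
    and single: "\<And>a. P (block e a)"
    and pair: "\<And>a b. P (block e a @ zeros b @ block e a)"
    and nest: "\<And>a b u. P u \<Longrightarrow> P (block e a @ zeros b @ u @ zeros b @ block e a)"
  shows "P w"
proof -
  have "P (even_form (\<lambda>j. block e (l j)) m i) \<and> P (odd_form (\<lambda>j. block e (l j)) m i)"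
    if "1 \<le> i" for i and l m :: "nat \<Rightarrow> nat"
    using that
  proof (induction i arbitrary: l m rule: nat_induct_at_least)
    case base
    show ?case unfolding forms_1 using single pair by blast
  next
    case (Suc i)
    then show ?case
      using forms_Suc[of i "\<lambda>j. block e (l j)" "\<lambda>j. block e (l (Suc j))" m "\<lambda>j. m (Suc j)"]
        nest Suc.IH[of "\<lambda>j. l (Suc j)" "\<lambda>j. m (Suc j)"] by simp
  qed
  then show ?thesis using assms(1) unfolding block_form_def by blast
qed


section \<open>Digit strings balanced without carries\<close>

text \<open>
  The path from the state \<open>(k-1, k-1)\<close>: it stays on the loop of nines, and either stops there (the
  block being written is the central one) or leaves and completes the block on both sides.
\<close>

lemma balanced_carry_carry_nines:
  assumes ke: "block_case k e"
  shows "\<lbrakk>balanced k (k - 1) (k - 1) w; \<forall>z\<in>set w. z < 10\<rbrakk> \<Longrightarrow>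
    (\<exists>l. w = nines l) \<or>
    (\<exists>l u. w = nines l @ [9 - e, 10 - e] @ u @ [e, e - 1] @ nines l \<and> balanced k 0 0 u)"
proof (induction w rule: length_induct)
  case (1 w)
  from ke "1.prems" show ?case
  proof (cases rule: balanced_carry_carry_cases)
    case 1
    then have "w = nines 0" by (simp add: nines_def)
    then show ?thesis by blast
  next
    case 2
    then have "w = nines 1" by (simp add: nines_def)
    then show ?thesis by blast
  next
    case (3 u)
    then have "(\<exists>l. u = nines l) \<or>
      (\<exists>l v. u = nines l @ [9 - e, 10 - e] @ v @ [e, e - 1] @ nines l \<and> balanced k 0 0 v)"
      using "1.IH"[rule_format, of u] "1.prems" by simp
    then show ?thesis
    proof (elim disjE exE conjE)
      fix l assume "u = nines l"
      then have "w = nines (Suc (Suc l))" using 3 by (simp add: nines_def replicate_append_same)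
      then show ?thesis by blast
    next
      fix l v assume "u = nines l @ [9 - e, 10 - e] @ v @ [e, e - 1] @ nines l"
        and v: "balanced k 0 0 v"
      then have "w = (9 # nines l) @ [9 - e, 10 - e] @ v @ [e, e - 1] @ (nines l @ [9])"
        using 3 by simp
      then show ?thesis using v nines_Suc by metis
    qed
  next
    case (4 u)
    have "\<forall>z\<in>set u. z < 10" using 4 "1.prems" by simp
    with ke 4(2) obtain v where "u = (10 - e) # v @ [e]" "balanced k 0 0 v"
      by (rule balanced_0_carry_cases)
    moreover from this have "w = nines 0 @ [9 - e, 10 - e] @ v @ [e, e - 1] @ nines 0"
      using 4 by (simp add: nines_def)
    ultimately show ?thesis by blast
  qed
qed

text \<open>
  One turn round the cycle strips one block from each end, so induction on the length applies.
  Strings that begin and end with zeros have to be included, as they remain between two blocks; the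
  zeros stripped there are the separating ones of the form around them.
\<close>

lemma balanced_0_0_imp_block_form:
  assumes ke: "block_case k e"
  shows "\<lbrakk>balanced k 0 0 w; \<forall>z\<in>set w. z < 10\<rbrakk> \<Longrightarrow>
    (\<exists>n. w = zeros n) \<or> (\<exists>n u. w = zeros n @ u @ zeros n \<and> block_form e u)"
proof (induction w rule: length_induct)
  case (1 w)
  from ke "1.prems" show ?case
  proof (cases rule: balanced_0_0_cases)
    case 1
    then have "w = zeros 0" by (simp add: zeros_def)
    then show ?thesis by blast
  next
    case 2
    then have "w = zeros 1" by (simp add: zeros_def)
    then show ?thesis by blast
  next
    case (3 u)
    then have "(\<exists>n. u = zeros n) \<or> (\<exists>n v. u = zeros n @ v @ zeros n \<and> block_form e v)"
      using "1.IH"[rule_format, of u] "1.prems" by simp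
    then show ?thesis
    proof (elim disjE exE conjE)
      fix n assume "u = zeros n"
      then have "w = zeros (Suc (Suc n))" using 3 by (simp add: zeros_def replicate_append_same)
      then show ?thesis by blast
    next
      fix n v assume "u = zeros n @ v @ zeros n" and v: "block_form e v"
      then have "w = (0 # zeros n) @ v @ (zeros n @ [0])" using 3 by simp
      then show ?thesis using v zeros_Suc by metis
    qed
  next
    case (4 u)
    have "\<forall>z\<in>set u. z < 10" using 4 "1.prems" by simp
    with ke 4(2) obtain v where v: "u = (e - 1) # v @ [9 - e]" "balanced k (k - 1) (k - 1) v"
      by (rule balanced_carry_0_cases)
    have w: "w = [e, e - 1] @ v @ [9 - e, 10 - e]" using 4 v by simp
    have "(\<exists>l. v = nines l) \<or>
      (\<exists>l s. v = nines l @ [9 - e, 10 - e] @ s @ [e, e - 1] @ nines l \<and> balanced k 0 0 s)"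
      using balanced_carry_carry_nines[OF ke v(2)] "1.prems" w by simp
    then have "block_form e w"
    proof (elim disjE exE conjE)
      fix l assume "v = nines l"
      then have "w = block e l" using w by (simp add: block_def)
      then show ?thesis using block_form_single by simp
    next
      fix l s assume s: "v = nines l @ [9 - e, 10 - e] @ s @ [e, e - 1] @ nines l"
        "balanced k 0 0 s"
      have ws: "w = block e l @ s @ block e l" using w s by (simp add: block_def)
      then have "(\<exists>n. s = zeros n) \<or> (\<exists>n u. s = zeros n @ u @ zeros n \<and> block_form e u)"
        using "1.IH"[rule_format, of s] "1.prems" s by (simp add: block_def)
      then show ?thesis
        using ws block_form_pair block_form_nest by auto
    qed
    moreover have "w = zeros 0 @ w @ zeros 0" by (simp add: zeros_def)
    ultimately show ?thesis by blast
  qed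
qed

lemma balanced_0_0_sandwich:
  assumes "balanced k 0 0 a" "balanced k 0 0 u"
  shows "balanced k 0 0 (a @ u @ a)"
proof -
  have "digit_value (rev a) = k * digit_value a" "digit_value (rev u) = k * digit_value u"
    using assms by (auto simp: balanced_def)
  then show ?thesis by (simp add: balanced_def algebra_simps)
qed

lemma balanced_zeros: "balanced k 0 0 (zeros n)"
proof -
  have "rev (zeros n) = zeros n" by (simp add: zeros_def)
  then show ?thesis by (simp add: balanced_def)
qed

text \<open>
  A block has value \<open>11 * e * (100 * 10 ^ l - 1)\<close> and its reversal has value
  \<open>11 * (10 - e) * (100 * 10 ^ l - 1)\<close>; the quotient is \<open>(10 - e) div e = k\<close>.
\<close>

lemma balanced_block:
  assumes "block_case k e"
  shows "balanced k 0 0 (block e l)"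
proof -
  obtain N where N: "digit_value (nines l) = N" "10 ^ l = N + 1"
    using digit_value_nines[of l] by metis
  have "rev (nines l) = nines l" "length (nines l) = l" by (simp_all add: nines_def)
  then show ?thesis
    using assms N by (auto simp: balanced_def block_def block_case_def)
qed

lemma block_form_imp_balanced:
  assumes "block_case k e" "block_form e w"
  shows "balanced k 0 0 w"
  using assms(2)
proof (induction rule: block_form_induct)
  case (single a)
  then show ?case using balanced_block assms(1) by blast
next
  case (pair a b)
  then show ?case
    using balanced_0_0_sandwich balanced_block[OF assms(1)] balanced_zeros by blast
next
  case (nest a b u)
  then show ?case
    using balanced_0_0_sandwich[OF balanced_block[OF assms(1), of a]
        balanced_0_0_sandwich[OF balanced_zeros[of k b] nest]] by simp
qed

lemma balanced_0_0_iff_block_form: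
  assumes "block_case k e" "w \<noteq> []" "hd w \<noteq> 0" "\<forall>z\<in>set w. z < 10"
  shows "balanced k 0 0 w \<longleftrightarrow> block_form e w"
proof
  assume "balanced k 0 0 w"
  then consider n where "w = zeros n" | n u where "w = zeros n @ u @ zeros n" "block_form e u"
    using balanced_0_0_imp_block_form assms by blast
  then show "block_form e w"
  proof cases
    case (1 n)
    then show ?thesis using assms(2,3) by (cases n) (auto simp: zeros_def)
  next
    case (2 n u)
    then show ?thesis using assms(2,3) by (cases n) (auto simp: zeros_def)
  qed
qed (rule block_form_imp_balanced[OF assms(1)])

theorem theorem5:
  fixes M k :: nat
  assumes "M > 0" and "1 \<le> k" and "k < 10"
  shows "reverse_multiple k M \<longleftrightarrow>
      (k = 1 \<and> palindrome M)
    \<or> (k = 4 \<and> (\<exists>i\<ge>1. \<exists>l m :: nat \<Rightarrow> nat.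
          decimal_expansion M = even_form (\<lambda>j. block_B (l j)) m i
        \<or> decimal_expansion M = odd_form (\<lambda>j. block_B (l j)) m i))
    \<or> (k = 9 \<and> (\<exists>i\<ge>1. \<exists>l m :: nat \<Rightarrow> nat.
          decimal_expansion M = even_form (\<lambda>j. block_C (l j)) m i
        \<or> decimal_expansion M = odd_form (\<lambda>j. block_C (l j)) m i))"
proof -
  let ?w = "decimal_expansion M"
  note w = decimal_expansion_not_Nil[of M] hd_decimal_expansion[OF assms(1)]
    decimal_expansion_digits[of M]
  have balanced: "reverse_multiple k M \<longleftrightarrow> balanced k 0 0 ?w"
    using reverse_multiple_iff_digit_value[OF assms(2)] assms(1) by (simp add: balanced_def)
  have k: "k = 1 \<or> k = 4 \<or> k = 9" if "reverse_multiple k M"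
    using multiplier_1_4_9[OF _ w assms(2,3)] that balanced by blast
  have "reverse_multiple 1 M \<longleftrightarrow> palindrome M"
    using assms(1) by (auto simp: reverse_multiple_def palindrome_def)
  moreover have "balanced 4 0 0 ?w \<longleftrightarrow> block_form 2 ?w" "balanced 9 0 0 ?w \<longleftrightarrow> block_form 1 ?w"
    using w by (intro balanced_0_0_iff_block_form; simp add: block_case_def)+
  ultimately show ?thesis
    using k balanced unfolding block_B_eq block_C_eq block_form_def[symmetric] by auto
qed

end
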